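(* Let $k \ge 3$ and $m \ge 1$ be integers. Then $$p(km - 1, k) = \sum_{j \geq m} \binom{km - 1}{j}.$$ Moreover, the only $k$-partition-free family $\mathcal F \subset 2^{[km-1]}$ with $|\mathcal F| = \sum_{j \geq m} \binom{km - 1}{j}$ is $\mathcal F = \bigl\{G \subset [km - 1] : |G| \geq m\bigr\}$.
   Context: $[n] = \{1,2,\dots,n\}$ and $2^{[n]}$ is its power set. For $k \ge 3$, a family $\mathcal F \subset 2^{[n]}$ is called $k$-partition-free if $\mathcal F$ contains no $k$ pairwise disjoint members whose union is $[n]$; that is, there is no $k$-tuple $(F_1,\dots,F_k)$ with all $F_i \in \mathcal F$, $F_i \cap F_j = \emptyset$ for $i \ne j$, and $F_1 \cup \dots \cup F_k = [n]$. (The $F_i$ are not required to be distinct, so the empty set, if it belongs to $\mathcal F$, may be used several times.) For positive integers $n$ and $k\ge 3$, $p(n,k)$ denotes the maximum of $|\mathcal F|$ over all $k$-partition-free families $\mathcal F \subset 2^{[n]}$. *)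

theory Defs
  imports Main "HOL-Library.Disjoint_Sets"
begin

(* The k-tuple (F_1, ..., F_k) is a function on the index set {1..k}. Disjointness is required
   for distinct indices, not distinct values, so the empty set may be repeated. *)
definition partition_free :: "nat \<Rightarrow> nat \<Rightarrow> nat set set \<Rightarrow> bool" where
  "partition_free n k \<F> \<longleftrightarrow>
     \<F> \<subseteq> Pow {1..n} \<and>
     \<not> (\<exists>F :: nat \<Rightarrow> nat set. (\<forall>i\<in>{1..k}. F i \<in> \<F>) \<and> disjoint_family_on F {1..k} \<and>
          (\<Union>i\<in>{1..k}. F i) = {1..n})"

(* The Max is over a finite set, nonempty for k \<ge> 1 because the empty family is partition-free. *)
definition max_partition_free :: "nat \<Rightarrow> nat \<Rightarrow> nat" where
  "max_partition_free n k = Max {card \<F> | \<F>. partition_free n k \<F>}"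

end

theory Submission
  imports Defs Complex_Main
begin

text \<open>
  Write \<open>n = k m - 1\<close> and let \<open>q\<^sub>j\<close> be the proportion of \<open>j\<close>-subsets of \<open>[n]\<close> that a
  \<open>k\<close>-partition-free family \<open>\<F>\<close> misses. The number of missing sets is
  \<open>\<Sum>\<^sub>j q\<^sub>j (n choose j)\<close>, and the claim is that it is at least
  \<open>\<Sum>\<^sub>j\<^sub><\<^sub>m (n choose j)\<close>, the value at \<open>q\<^sub>j = 1\<close> for \<open>j < m\<close> and \<open>q\<^sub>j = 0\<close> otherwise.

  The heart of the proof is the unweighted bound \<open>\<Sum>\<^sub>j q\<^sub>j \<ge> (n + 1) / k = m\<close>. It is the
  diagonal case of an inequality for \<open>k\<close> families none of whose transversals partition the
  ground set (\<open>sum_deficit_cross_partition_free\<close>): the sum of all their missing proportions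
  is at least \<open>n + 1\<close>. With several families an induction on \<open>n\<close> goes through. Deleting a
  point \<open>x\<close>, one family is replaced by its link at \<open>x\<close> and the others by their restrictions
  to sets avoiding \<open>x\<close>, and a partition of the smaller ground set extends by putting \<open>x\<close>
  into the linked class. Averaged over \<open>x\<close>, the missing proportions of a link and of a
  restriction are those of the family itself, except that a link forgets the level \<open>0\<close> and a
  restriction forgets the level \<open>n\<close>. At least one missing set is forgotten altogether, which
  supplies the \<open>1\<close> that the induction needs.

  To pass to binomial weights, \<open>q\<close> has to be nonincreasing, which holds when \<open>\<F>\<close> is closed
  under supersets (\<open>missing_fraction_Suc_le\<close>). With \<open>c = n choose (m - 1)\<close> the levels below
  \<open>m\<close> weigh at most \<open>c\<close>, the levels from \<open>m\<close> to \<open>n - m\<close> at least \<open>2 c\<close>, and the \<open>m\<close> top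
  levels, whose weights may be small, are compensated by the middle ones because \<open>q\<close> is
  nonincreasing (\<open>sum_antitone_weights_ge\<close>). Equality leaves no missing set of size at
  least \<open>m\<close>.

  An arbitrary family is first compressed upwards, which keeps its size and its
  partition-freeness (\<open>cross_partition_free_up_compress\<close>). For uniqueness one checks that
  the family of all sets of size at least \<open>m\<close> arises by such a step only from itself
  (\<open>up_compress_eq_large_sets\<close>); that step moves a point into
  a third part of a partition.
\<close>

section \<open>Families without a partitioning transversal\<close>

definition cross_partition_free :: "'i set \<Rightarrow> 'a set \<Rightarrow> ('i \<Rightarrow> 'a set set) \<Rightarrow> bool" where
  "cross_partition_free I S \<F> \<longleftrightarrow>
     \<not> (\<exists>P. (\<forall>i\<in>I. P i \<in> \<F> i) \<and> disjoint_family_on P I \<and> (\<Union>i\<in>I. P i) = S)"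

lemma cross_partition_freeD:
  assumes "cross_partition_free I S \<F>" "\<And>i. i \<in> I \<Longrightarrow> P i \<in> \<F> i"
    "disjoint_family_on P I" "(\<Union>i\<in>I. P i) = S"
  shows False
  using assms unfolding cross_partition_free_def by blast

lemma cross_partition_free_link:
  assumes free: "cross_partition_free I S \<F>" and x: "x \<in> S" and i: "i \<in> I"
  shows "cross_partition_free I (S - {x}) (\<F>(i := {G. insert x G \<in> \<F> i}))"
  unfolding cross_partition_free_def
proof (rule notI, elim exE conjE)
  fix P
  assume mem: "\<forall>j\<in>I. P j \<in> (\<F>(i := {G. insert x G \<in> \<F> i})) j"
    and disj: "disjoint_family_on P I" and un: "(\<Union>j\<in>I. P j) = S - {x}"
  show False
  proof (rule cross_partition_freeD[OF free])
    show "\<And>j. j \<in> I \<Longrightarrow> (P(i := insert x (P i))) j \<in> \<F> j"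
      using mem by (auto split: if_splits)
    have "x \<notin> P j" if "j \<in> I" for j using un that by blast
    then show "disjoint_family_on (P(i := insert x (P i))) I"
      using disj i by (simp add: disjoint_family_on_def)
    show "(\<Union>j\<in>I. (P(i := insert x (P i))) j) = S"
      using un x i by (auto split: if_splits)
  qed
qed

section \<open>The total proportion of missing sets\<close>

text \<open>
  The sum over all levels of the proportion of missing sets. Equivalently, the expected number
  of missing members of a uniformly random maximal chain from \<open>{}\<close> to \<open>S\<close>.
\<close>
definition deficit :: "'a set \<Rightarrow> 'a set set \<Rightarrow> real" where
  "deficit S \<F> = (\<Sum>G\<in>Pow S - \<F>. 1 / real (card S choose card G))"

text \<open>
  A \<open>j\<close>-set with \<open>j < n\<close> survives in \<open>n - j\<close> of the sets \<open>S - {x}\<close>, and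
  \<open>(n - j) (n choose j) = n (n - 1 choose j)\<close>; hence its weights there add up to \<open>n\<close> times
  its weight in \<open>S\<close>. Only \<open>S\<close> itself is lost.
\<close>
lemma deficit_deletion:
  assumes "finite S"
  shows "(\<Sum>x\<in>S. deficit (S - {x}) \<F>) = card S * (deficit S \<F> - of_bool (S \<notin> \<F>))"
proof -
  let ?n = "card S"
  have "(\<Sum>x\<in>S. deficit (S - {x}) \<F>)
      = (\<Sum>x\<in>S. \<Sum>G\<in>{G \<in> Pow S - \<F>. x \<notin> G}. 1 / real ((?n - 1) choose card G))"
    unfolding deficit_def using assms by (intro sum.cong) auto
  also have "\<dots> = (\<Sum>G\<in>Pow S - \<F>. \<Sum>x\<in>{x\<in>S. x \<notin> G}. 1 / real ((?n - 1) choose card G))"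
    using assms by (intro sum.swap_restrict) auto
  also have "\<dots> = (\<Sum>G\<in>Pow S - \<F>. ?n / real (?n choose card G) - (if G = S then ?n else 0))"
  proof (intro sum.cong refl)
    fix G assume "G \<in> Pow S - \<F>"
    then have G: "G \<subseteq> S" by blast
    then have fG: "finite G" using assms finite_subset by blast
    have "{x\<in>S. x \<notin> G} = S - G" by blast
    then have c: "card {x\<in>S. x \<notin> G} = ?n - card G" using card_Diff_subset[OF fG G] by simp
    show "(\<Sum>x\<in>{x\<in>S. x \<notin> G}. 1 / real ((?n - 1) choose card G))
        = ?n / real (?n choose card G) - (if G = S then ?n else 0)"
    proof (cases "G = S")
      case False
      then have less: "card G < ?n" using G assms psubset_card_mono by blast
      then obtain N where N: "?n = Suc N" by (cases ?n) auto
      have "(Suc N - card G) * (Suc N choose card G) = Suc N * (N choose card G)"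
        using less N by (simp add: binomial_absorb_comp)
      then have "real (Suc N - card G) * real (Suc N choose card G) = real (Suc N) * real (N choose card G)"
        by (metis of_nat_mult)
      moreover have "real (Suc N choose card G) > 0" "real (N choose card G) > 0"
        using less N by (auto simp: zero_less_binomial_iff)
      ultimately show ?thesis using False c N by (simp add: field_simps)
    qed (use c in auto)
  qed
  also have "\<dots> = ?n * deficit S \<F> - (\<Sum>G\<in>Pow S - \<F>. if G = S then ?n else 0)"
    by (simp add: deficit_def sum_subtractf sum_distrib_left)
  also have "(\<Sum>G\<in>Pow S - \<F>. if G = S then ?n else 0) = ?n * of_bool (S \<notin> \<F>)"
    using assms by (simp add: sum.delta)
  finally show ?thesis by (simp add: algebra_simps)
qed

text \<open>
  The mirror image of the previous lemma: a \<open>j\<close>-set \<open>H\<close> with \<open>j > 0\<close> contributes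
  \<open>H - {x}\<close> for each of its \<open>j\<close> points, and \<open>j (n choose j) = n (n - 1 choose j - 1)\<close>. Now
  the empty set is the one that is lost.
\<close>
lemma deficit_link:
  assumes "finite S"
  shows "(\<Sum>x\<in>S. deficit (S - {x}) {G. insert x G \<in> \<F>})
    = card S * (deficit S \<F> - of_bool ({} \<notin> \<F>))"
proof -
  let ?n = "card S"
  have "(\<Sum>x\<in>S. deficit (S - {x}) {G. insert x G \<in> \<F>})
      = (\<Sum>x\<in>S. \<Sum>H\<in>{H \<in> Pow S - \<F>. x \<in> H}. 1 / real ((?n - 1) choose (card H - 1)))"
  proof (rule sum.cong[OF refl])
    fix x assume x: "x \<in> S"
    show "deficit (S - {x}) {G. insert x G \<in> \<F>}
        = (\<Sum>H\<in>{H \<in> Pow S - \<F>. x \<in> H}. 1 / real ((?n - 1) choose (card H - 1)))"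
      unfolding deficit_def
      by (rule sum.reindex_bij_witness[of _ "\<lambda>H. H - {x}" "insert x"])
        (use x assms in \<open>auto simp: insert_absorb finite_subset card_insert_if\<close>)
  qed
  also have "\<dots> = (\<Sum>H\<in>Pow S - \<F>. \<Sum>x\<in>{x\<in>S. x \<in> H}. 1 / real ((?n - 1) choose (card H - 1)))"
    using assms by (intro sum.swap_restrict) auto
  also have "\<dots> = (\<Sum>H\<in>Pow S - \<F>. ?n / real (?n choose card H) - (if H = {} then ?n else 0))"
  proof (intro sum.cong refl)
    fix H assume "H \<in> Pow S - \<F>"
    then have H: "H \<subseteq> S" by blast
    then have fH: "finite H" using assms finite_subset by blast
    have c: "{x\<in>S. x \<in> H} = H" using H by blast
    show "(\<Sum>x\<in>{x\<in>S. x \<in> H}. 1 / real ((?n - 1) choose (card H - 1)))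
        = ?n / real (?n choose card H) - (if H = {} then ?n else 0)"
    proof (cases "H = {}")
      case False
      then have "card H > 0" using fH by (simp add: card_gt_0_iff)
      then obtain h where h: "card H = Suc h" by (cases "card H") auto
      have le: "card H \<le> ?n" using H assms by (simp add: card_mono)
      then obtain N where N: "?n = Suc N" using h by (cases ?n) auto
      have "Suc h * (Suc N choose Suc h) = Suc N * (N choose h)"
        by (rule Suc_times_binomial)
      then have "real (Suc h) * real (Suc N choose Suc h) = real (Suc N) * real (N choose h)"
        by (metis of_nat_mult)
      moreover have "real (Suc N choose Suc h) > 0" "real (N choose h) > 0"
        using le N h by (auto simp: zero_less_binomial_iff simp del: binomial_Suc_Suc)
      ultimately show ?thesis using False c N h
        by (simp add: field_simps del: binomial_Suc_Suc)
    qed (use c in auto)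
  qed
  also have "\<dots> = ?n * deficit S \<F> - (\<Sum>H\<in>Pow S - \<F>. if H = {} then ?n else 0)"
    by (simp add: deficit_def sum_subtractf sum_distrib_left)
  also have "(\<Sum>H\<in>Pow S - \<F>. if H = {} then ?n else 0) = ?n * of_bool ({} \<notin> \<F>)"
    using assms by (simp add: sum.delta)
  finally show ?thesis by (simp add: algebra_simps)
qed

text \<open>
  Equality holds, for instance, when \<open>\<F> i\<close> consists of all sets of size at least \<open>a i\<close>, where
  the thresholds satisfy \<open>0 \<le> a i \<le> n + 1\<close> and add up to \<open>n + 1\<close>. A single family would not do:
  one that merely avoids \<open>S\<close> has deficit \<open>1\<close>.
\<close>
lemma sum_deficit_cross_partition_free:
  assumes "finite S" "finite I" "card I \<ge> 2" "cross_partition_free I S \<F>"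
  shows "(\<Sum>i\<in>I. deficit S (\<F> i)) \<ge> card S + 1"
  using assms(1,4)
proof (induction "card S" arbitrary: S \<F>)
  case 0
  then have S: "S = {}" by simp
  obtain i where i: "i \<in> I" "{} \<notin> \<F> i"
    using cross_partition_freeD[OF 0(3), of "\<lambda>_. {}"] S by (auto simp: disjoint_family_on_def)
  have "1 = deficit S (\<F> i)" using i S by (simp add: deficit_def insert_Diff_if)
  also have "\<dots> \<le> (\<Sum>i\<in>I. deficit S (\<F> i))"
    using i assms by (intro member_le_sum) (auto simp: deficit_def intro: sum_nonneg)
  finally show ?case using S by simp
next
  case (Suc n)
  (* The family that is linked should miss the empty set, if any of the families does. *)
  define j where "j = (SOME j. j \<in> I \<and> ((\<exists>i\<in>I. {} \<notin> \<F> i) \<longrightarrow> {} \<notin> \<F> j))"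
  have "I \<noteq> {}" using assms by auto
  then have "\<exists>j. j \<in> I \<and> ((\<exists>i\<in>I. {} \<notin> \<F> i) \<longrightarrow> {} \<notin> \<F> j)" by blast
  then have j: "j \<in> I" "(\<exists>i\<in>I. {} \<notin> \<F> i) \<Longrightarrow> {} \<notin> \<F> j"
    unfolding j_def by (rule someI2_ex, blast)+
  (* The weight that averaging over the deleted point forgets. *)
  define loss where "loss i = (if i = j then of_bool ({} \<notin> \<F> j) else of_bool (S \<notin> \<F> i) :: real)" for i
  have loss: "(\<Sum>i\<in>I. loss i) \<ge> 1"
  proof -
    have "\<exists>i\<in>I. loss i = 1"
    proof (cases "\<exists>i\<in>I. {} \<notin> \<F> i")
      case True
      then show ?thesis using j by (auto simp: loss_def)
    next
      case False
      have "\<not> I \<subseteq> {j}" using assms card_mono[of "{j}" I] by auto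
      then obtain i where i: "i \<in> I" "i \<noteq> j" by blast
      (* Otherwise S at index i and empty sets elsewhere form a partition. *)
      have "S \<notin> \<F> i"
      proof
        assume "S \<in> \<F> i"
        then show False
          using False i by (intro cross_partition_freeD[OF Suc(4), of "\<lambda>l. if l = i then S else {}"])
            (auto simp: disjoint_family_on_def split: if_splits)
      qed
      then show ?thesis using i by (auto simp: loss_def)
    qed
    then obtain i where "i \<in> I" "loss i = 1" by blast
    then show ?thesis using member_le_sum[of i I loss] assms by (auto simp: loss_def)
  qed
  define \<G> where "\<G> x = \<F>(j := {G. insert x G \<in> \<F> j})" for x
  have step: "(\<Sum>x\<in>S. deficit (S - {x}) (\<G> x i)) = Suc n * (deficit S (\<F> i) - loss i)" for i
    using deficit_deletion[OF Suc(3), of "\<F> i"] deficit_link[OF Suc(3), of "\<F> j"] Suc(2)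
    by (cases "i = j") (simp_all add: \<G>_def loss_def del: of_nat_Suc)
  have "real (Suc n * Suc n) = (\<Sum>x\<in>S. real (n + 1))"
    using Suc(2) by simp
  also have "\<dots> \<le> (\<Sum>x\<in>S. \<Sum>i\<in>I. deficit (S - {x}) (\<G> x i))"
  proof (rule sum_mono)
    fix x assume x: "x \<in> S"
    have c: "card (S - {x}) = n" using x Suc(2,3) by simp
    show "real (n + 1) \<le> (\<Sum>i\<in>I. deficit (S - {x}) (\<G> x i))"
      using Suc(1)[of "S - {x}" "\<G> x"] c Suc(3) cross_partition_free_link[OF Suc(4) x j(1)]
      by (simp add: \<G>_def)
  qed
  also have "\<dots> = (\<Sum>i\<in>I. \<Sum>x\<in>S. deficit (S - {x}) (\<G> x i))"
    by (rule sum.swap)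
  also have "\<dots> = Suc n * ((\<Sum>i\<in>I. deficit S (\<F> i)) - (\<Sum>i\<in>I. loss i))"
    by (simp add: step sum_subtractf sum_distrib_left right_diff_distrib del: of_nat_Suc)
  finally have "real (Suc n) \<le> (\<Sum>i\<in>I. deficit S (\<F> i)) - (\<Sum>i\<in>I. loss i)"
    by (metis mult_le_cancel_left_pos of_nat_0_less_iff of_nat_mult zero_less_Suc)
  then show ?case using loss Suc(2) by simp
qed

section \<open>Levels of a family closed under supersets\<close>

definition missing :: "'a set \<Rightarrow> 'a set set \<Rightarrow> nat \<Rightarrow> 'a set set" where
  "missing S \<F> j = {G. G \<subseteq> S \<and> card G = j \<and> G \<notin> \<F>}"

definition missing_fraction :: "'a set \<Rightarrow> 'a set set \<Rightarrow> nat \<Rightarrow> real" where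
  "missing_fraction S \<F> j = card (missing S \<F> j) / real (card S choose j)"

lemma finite_missing: "finite S \<Longrightarrow> finite (missing S \<F> j)"
  by (rule finite_subset[of _ "Pow S"]) (auto simp: missing_def)

lemma card_missing_le: "finite S \<Longrightarrow> card (missing S \<F> j) \<le> card S choose j"
  unfolding n_subsets[of S j, symmetric] by (rule card_mono) (auto simp: missing_def)

lemma sum_missing:
  fixes f :: "nat \<Rightarrow> real"
  assumes "finite S"
  shows "(\<Sum>G\<in>Pow S - \<F>. f (card G)) = (\<Sum>j\<le>card S. card (missing S \<F> j) * f j)"
proof -
  have "(\<Sum>G\<in>Pow S - \<F>. f (card G)) = (\<Sum>j\<le>card S. \<Sum>G\<in>{G \<in> Pow S - \<F>. card G = j}. f (card G))"
    using assms by (intro sum.group[symmetric]) (auto intro: card_mono)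
  also have "\<dots> = (\<Sum>j\<le>card S. card (missing S \<F> j) * f j)"
  proof (rule sum.cong[OF refl])
    fix j
    have "{G \<in> Pow S - \<F>. card G = j} = missing S \<F> j" by (auto simp: missing_def)
    moreover have "(\<Sum>G\<in>missing S \<F> j. f (card G)) = (\<Sum>G\<in>missing S \<F> j. f j)"
      by (rule sum.cong) (auto simp: missing_def)
    ultimately show "(\<Sum>G\<in>{G \<in> Pow S - \<F>. card G = j}. f (card G)) = card (missing S \<F> j) * f j"
      by simp
  qed
  finally show ?thesis .
qed

lemma deficit_eq_sum_missing_fraction:
  "finite S \<Longrightarrow> deficit S \<F> = (\<Sum>j\<le>card S. missing_fraction S \<F> j)"
  using sum_missing[of S "\<lambda>j. 1 / real (card S choose j)" \<F>]
  by (simp add: deficit_def missing_fraction_def)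

text \<open>
  The local LYM inequality: every \<open>j\<close>-subset of a missing \<open>(j + 1)\<close>-set is missing, so it
  suffices to count pairs of a missing \<open>(j + 1)\<close>-set and a point of it.
\<close>
lemma missing_fraction_Suc_le:
  assumes fin: "finite S" and j: "j < card S"
    and up: "\<And>G x. G \<in> \<F> \<Longrightarrow> x \<in> S \<Longrightarrow> insert x G \<in> \<F>"
  shows "missing_fraction S \<F> (Suc j) \<le> missing_fraction S \<F> j"
proof -
  let ?n = "card S"
  have "card (Sigma (missing S \<F> (Suc j)) (\<lambda>H. H)) \<le> card (Sigma (missing S \<F> j) (\<lambda>G. S - G))"
  proof (rule card_inj_on_le[of "\<lambda>(H, x). (H - {x}, x)"])
    show "inj_on (\<lambda>(H, x). (H - {x}, x)) (Sigma (missing S \<F> (Suc j)) (\<lambda>H. H))"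
      by (auto simp: inj_on_def)
    show "(\<lambda>(H, x). (H - {x}, x)) ` Sigma (missing S \<F> (Suc j)) (\<lambda>H. H)
        \<subseteq> Sigma (missing S \<F> j) (\<lambda>G. S - G)"
    proof clarsimp
      fix H x assume H: "H \<in> missing S \<F> (Suc j)" and x: "x \<in> H"
      have "insert x (H - {x}) = H" using x by blast
      then have "H - {x} \<notin> \<F>" using up[of "H - {x}" x] H x by (auto simp: missing_def)
      moreover have "finite H" using H fin finite_subset by (auto simp: missing_def)
      ultimately show "H - {x} \<in> missing S \<F> j \<and> x \<in> S"
        using H x by (auto simp: missing_def)
    qed
    show "finite (Sigma (missing S \<F> j) (\<lambda>G. S - G))"
      using fin by (intro finite_SigmaI finite_missing) auto
  qed
  also have "card (Sigma (missing S \<F> j) (\<lambda>G. S - G)) = (\<Sum>G\<in>missing S \<F> j. card (S - G))"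
    using fin by (intro card_SigmaI) (auto simp: finite_missing)
  also have "\<dots> = (\<Sum>G\<in>missing S \<F> j. ?n - j)"
    using fin by (intro sum.cong) (auto simp: missing_def card_Diff_subset finite_subset)
  also have "card (Sigma (missing S \<F> (Suc j)) (\<lambda>H. H)) = (\<Sum>H\<in>missing S \<F> (Suc j). card H)"
    using fin by (intro card_SigmaI) (auto simp: finite_missing missing_def finite_subset)
  also have "\<dots> = (\<Sum>H\<in>missing S \<F> (Suc j). Suc j)"
    by (intro sum.cong) (auto simp: missing_def)
  finally have "card (missing S \<F> (Suc j)) * Suc j \<le> card (missing S \<F> j) * (?n - j)"
    by simp
  then have le: "real (card (missing S \<F> (Suc j))) * Suc j \<le> real (card (missing S \<F> j)) * (?n - j)"
    by (metis of_nat_le_iff of_nat_mult)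
  have "Suc j * (?n choose Suc j) = (?n - j) * (?n choose j)"
    by (simp only: binomial_absorption binomial_absorb_comp)
  then have eq: "real (Suc j) * (?n choose Suc j) = real (?n - j) * (?n choose j)"
    by (metis of_nat_mult)
  have pos: "real (?n choose Suc j) > 0" "real (?n choose j) > 0" "real (Suc j) > 0"
    using j by (auto simp: zero_less_binomial_iff)
  have "missing_fraction S \<F> (Suc j) = real (card (missing S \<F> (Suc j))) * real (Suc j) / (real (Suc j) * (?n choose Suc j))"
    using pos by (simp add: missing_fraction_def del: of_nat_Suc)
  also have "\<dots> \<le> real (card (missing S \<F> j)) * real (?n - j) / (real (Suc j) * (?n choose Suc j))"
    using le by (intro divide_right_mono) auto
  also have "\<dots> = missing_fraction S \<F> j"
    unfolding eq using pos j by (simp add: missing_fraction_def)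
  finally show ?thesis .
qed


section \<open>From uniform to binomial weights\<close>

text \<open>
  Subtracting \<open>c\<close> times the hypothesis \<open>m \<le> \<Sum>\<^sub>j q j\<close> from the claim leaves
  \<open>(\<Sum>j<m. (c - b j) * (1 - q j)) + (\<Sum>j=m..n. (b j - c) * q j) \<ge> 0\<close>.
  The first sum is nonnegative term by term. In the second, a coefficient is at least \<open>c\<close> on
  \<open>A = {m..n - m}\<close> and greater than \<open>- c\<close> on the \<open>m\<close> top levels \<open>B\<close>; as \<open>A\<close> has at least \<open>m\<close>
  elements and \<open>q\<close> is nonincreasing, \<open>A\<close> outweighs \<open>B\<close>.
\<close>
lemma sum_antitone_weights_ge:
  fixes b q :: "nat \<Rightarrow> real" and c :: real
  assumes q: "\<And>j. j \<le> n \<Longrightarrow> 0 \<le> q j" "\<And>j. j \<le> n \<Longrightarrow> q j \<le> 1"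
    and antitone: "\<And>i j. i \<le> j \<Longrightarrow> j \<le> n \<Longrightarrow> q j \<le> q i"
    and sum_q: "real m \<le> (\<Sum>j\<le>n. q j)"
    and m: "m \<ge> 1" "3 * m \<le> n + 1"
    and c: "c > 0"
    and small: "\<And>j. j < m \<Longrightarrow> b j \<le> c"
    and middle: "\<And>j. m \<le> j \<Longrightarrow> j \<le> n - m \<Longrightarrow> 2 * c \<le> b j"
    and pos: "\<And>j. j \<le> n \<Longrightarrow> b j > 0"
  shows "(\<Sum>j<m. b j) \<le> (\<Sum>j\<le>n. b j * q j)"
    and "(\<Sum>j\<le>n. b j * q j) = (\<Sum>j<m. b j) \<Longrightarrow> m \<le> j \<Longrightarrow> j \<le> n \<Longrightarrow> q j = 0"
proof -
  define A B where "A = {m..n - m}" and "B = {n - m + 1..n}"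
  have split: "sum f {..n} = sum f {..<m} + sum f A + sum f B" for f :: "nat \<Rightarrow> real"
  proof -
    have "{..n} = {..<m} \<union> A \<union> B" "{..<m} \<inter> A = {}" "({..<m} \<union> A) \<inter> B = {}"
      using m by (auto simp: A_def B_def)
    then show ?thesis by (simp add: sum.union_disjoint A_def B_def)
  qed
  have "sum q B = (\<Sum>i<m. q (n - m + 1 + i))"
    unfolding B_def using m
    by (intro sum.reindex_bij_witness[of _ "\<lambda>i. n - m + 1 + i" "\<lambda>j. j - (n - m + 1)"]) auto
  also have "\<dots> \<le> (\<Sum>i<m. q (m + i))"
    using m by (intro sum_mono antitone) auto
  also have "\<dots> = sum q {m..<2 * m}"
    by (intro sum.reindex_bij_witness[of _ "\<lambda>j. j - m" "\<lambda>i. m + i"]) auto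
  also have "\<dots> \<le> sum q A"
    using m q by (intro sum_mono2) (auto simp: A_def)
  finally have tail: "sum q B \<le> sum q A" .
  have low: "0 \<le> (\<Sum>j<m. (c - b j) * (1 - q j))"
    using small q m by (intro sum_nonneg mult_nonneg_nonneg) auto
  have mid: "2 * c * sum q A \<le> (\<Sum>j\<in>A. b j * q j)"
    unfolding sum_distrib_left using middle q m
    by (intro sum_mono mult_right_mono) (auto simp: A_def)
  have top: "0 \<le> (\<Sum>j\<in>B. b j * q j)"
    using pos q by (intro sum_nonneg mult_nonneg_nonneg) (auto simp: B_def less_imp_le)
  (* Expanded so that linear arithmetic can combine it with the facts around it. *)
  have lowq: "(\<Sum>j<m. (c - b j) * (1 - q j))
      = c * m - c * (\<Sum>j<m. q j) - (\<Sum>j<m. b j) + (\<Sum>j<m. b j * q j)"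
    by (simp add: algebra_simps sum.distrib sum_subtractf sum_distrib_left)
  have scaled: "c * m \<le> c * ((\<Sum>j<m. q j) + sum q A + sum q B)" "c * sum q B \<le> c * sum q A"
    using sum_q tail c unfolding split[of q] by (simp_all add: mult_left_mono)
  have all: "(\<Sum>j\<le>n. b j * q j) = (\<Sum>j<m. b j * q j) + (\<Sum>j\<in>A. b j * q j) + (\<Sum>j\<in>B. b j * q j)"
    by (rule split)
  show "(\<Sum>j<m. b j) \<le> (\<Sum>j\<le>n. b j * q j)"
    using low mid top lowq scaled all by (simp add: algebra_simps)
  assume eq: "(\<Sum>j\<le>n. b j * q j) = (\<Sum>j<m. b j)"
  have "(\<Sum>j\<in>B. b j * q j) = 0"
    using low mid top lowq scaled all eq by (simp add: algebra_simps)
  then have "\<forall>j\<in>B. b j * q j = 0"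
    using pos q by (subst (asm) sum_nonneg_eq_0_iff) (auto simp: B_def less_imp_le)
  then have zeroB: "\<forall>j\<in>B. q j = 0" using pos by (fastforce simp: B_def)
  then have "sum q B = 0" by simp
  then have "c * sum q A \<le> 0"
    using low mid top lowq scaled all eq by (simp add: algebra_simps)
  then have "sum q A \<le> 0" using c by (simp add: mult_le_0_iff)
  moreover have "0 \<le> sum q A" using q by (intro sum_nonneg) (auto simp: A_def)
  ultimately have "sum q A = 0" by simp
  then have zeroA: "\<forall>j\<in>A. q j = 0"
    using q by (subst (asm) sum_nonneg_eq_0_iff) (auto simp: A_def)
  assume "m \<le> j" "j \<le> n"
  then have "j \<in> A \<or> j \<in> B" using m by (auto simp: A_def B_def)
  then show "q j = 0" using zeroA zeroB by blast
qed

text \<open>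
  For \<open>n = k m - 1\<close> the ratio of consecutive binomial coefficients at \<open>m\<close> is the integer
  \<open>(n - m + 1) / m = k - 1\<close>, which is at least \<open>2\<close>; unimodality does the rest.
\<close>
lemma twice_binomial_le_middle:
  assumes k: "k \<ge> 3" and m: "m \<ge> 1" and n: "n = k * m - 1" and j: "m \<le> j" "j \<le> n - m"
  shows "2 * (n choose (m - 1)) \<le> n choose j"
proof -
  have km: "3 * m \<le> k * m" using k by simp
  obtain l where l: "m = Suc l" using m by (cases m) auto
  have "Suc l * (n choose Suc l) = (n - l) * (n choose l)"
    by (simp only: binomial_absorption binomial_absorb_comp)
  moreover have "n - l = (k - 1) * Suc l"
    using n l k by (cases k) auto
  ultimately have "Suc l * (n choose Suc l) = Suc l * ((k - 1) * (n choose l))"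
    by (simp only: mult.assoc mult.left_commute)
  then have "n choose m = (k - 1) * (n choose (m - 1))"
    unfolding l by (simp only: mult_cancel1 nat.distinct diff_Suc_1 simp_thms)
  moreover have "2 * (n choose (m - 1)) \<le> (k - 1) * (n choose (m - 1))"
    using k by (intro mult_right_mono) auto
  moreover have "n choose m \<le> n choose j"
  proof (cases "2 * j \<le> n")
    case True
    then show ?thesis using j by (intro binomial_mono)
  next
    case False
    have jn: "j \<le> n" using j by simp
    have "n choose m \<le> n choose (n - j)"
      using False j m n km by (intro binomial_mono) auto
    then show ?thesis using binomial_symmetric[OF jn] by simp
  qed
  ultimately show ?thesis by linarith
qed

lemma card_subsets_card_ge:
  assumes "finite S"
  shows "card {G. G \<subseteq> S \<and> m \<le> card G} = (\<Sum>j=m..card S. card S choose j)"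
proof -
  have "{G. G \<subseteq> S \<and> m \<le> card G} = (\<Union>j\<in>{m..card S}. {G. G \<subseteq> S \<and> card G = j})"
    using assms by (auto intro: card_mono)
  moreover have "card (\<Union>j\<in>{m..card S}. {G. G \<subseteq> S \<and> card G = j})
      = (\<Sum>j=m..card S. card {G. G \<subseteq> S \<and> card G = j})"
    using assms by (intro card_UN_disjoint) auto
  ultimately show ?thesis using assms by (simp add: n_subsets)
qed

section \<open>The bound for families closed under supersets\<close>

lemma partition_free_upset_bound:
  assumes S: "finite S" "card S = k * m - 1" and I: "finite I" "card I = k"
    and k: "k \<ge> 3" and m: "m \<ge> 1"
    and sub: "\<F> \<subseteq> Pow S" and free: "cross_partition_free I S (\<lambda>_. \<F>)"
    and up: "\<And>G x. G \<in> \<F> \<Longrightarrow> x \<in> S \<Longrightarrow> insert x G \<in> \<F>"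
  shows "card \<F> \<le> (\<Sum>j=m..card S. card S choose j)"
    and "card \<F> = (\<Sum>j=m..card S. card S choose j) \<Longrightarrow> \<F> = {G. G \<subseteq> S \<and> m \<le> card G}"
proof -
  define n where "n = card S"
  define b where "b j = real (n choose j)" for j
  define q where "q = missing_fraction S \<F>"
  have km: "3 * m \<le> k * m" using k by simp
  then have nm: "3 * m \<le> n + 1" "n + 1 = k * m" using S m by (auto simp: n_def)
  have bpos: "b j > 0" if "j \<le> n" for j using that by (simp add: b_def)
  have q0: "0 \<le> q j" for j by (simp add: q_def missing_fraction_def)
  have q1: "q j \<le> 1" if "j \<le> n" for j
    using card_missing_le[OF S(1), of \<F> j] bpos[OF that]
    by (simp add: q_def missing_fraction_def b_def n_def)
  have antitone: "q j \<le> q i" if "i \<le> j" "j \<le> n" for i j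
    using that
  proof (induction j rule: dec_induct)
    case (step l)
    then show ?case
      using missing_fraction_Suc_le[OF S(1), of l \<F>] up by (force simp: q_def n_def)
  qed simp
  have "real (n + 1) \<le> k * deficit S \<F>"
    using sum_deficit_cross_partition_free[OF S(1) I(1) _ free] I(2) k by (simp add: n_def)
  then have "real k * m \<le> k * deficit S \<F>" unfolding nm(2) by simp
  then have sum_q: "real m \<le> (\<Sum>j\<le>n. q j)"
    using k by (simp add: deficit_eq_sum_missing_fraction[OF S(1)] q_def n_def)
  have c: "b (m - 1) > 0" using nm(1) by (intro bpos) simp
  have small: "b j \<le> b (m - 1)" if "j < m" for j
    using that nm(1) unfolding b_def of_nat_le_iff by (intro binomial_mono) auto
  have middle: "2 * b (m - 1) \<le> b j" if "m \<le> j" "j \<le> n - m" for j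
    using twice_binomial_le_middle[OF k m _ that] S(2) unfolding b_def n_def
    by (metis of_nat_le_iff of_nat_mult of_nat_numeral)
  have missing: "card (missing S \<F> j) = b j * q j" if "j \<le> n" for j
    using bpos[OF that] by (simp add: b_def q_def missing_fraction_def n_def)
  have "real (card (Pow S - \<F>)) = (\<Sum>j\<le>n. card (missing S \<F> j))"
    using sum_missing[OF S(1), of "\<lambda>_. 1" \<F>] by (simp add: n_def)
  also have "\<dots> = (\<Sum>j\<le>n. b j * q j)"
    using missing by (auto intro: sum.cong)
  finally have compl: "real (card (Pow S - \<F>)) = (\<Sum>j\<le>n. b j * q j)" .
  have "card (Pow S - \<F>) + card \<F> = 2 ^ n"
    using sub S(1) card_mono[of "Pow S" \<F>]
    by (subst card_Diff_subset) (auto simp: card_Pow n_def intro: finite_subset)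
  moreover have "2 ^ n = (\<Sum>j<m. n choose j) + (\<Sum>j=m..n. n choose j)"
  proof -
    have "{..n} = {..<m} \<union> {m..n}" "{..<m} \<inter> {m..n} = {}" using nm(1) by auto
    then show ?thesis unfolding choose_row_sum[symmetric] by (simp add: sum.union_disjoint)
  qed
  ultimately have "real (card (Pow S - \<F>)) + real (card \<F>)
      = real (\<Sum>j<m. n choose j) + real (\<Sum>j=m..n. n choose j)"
    by (metis of_nat_add)
  then have total: "(\<Sum>j\<le>n. b j * q j) + real (card \<F>) = (\<Sum>j<m. b j) + real (\<Sum>j=m..n. n choose j)"
    unfolding compl by (simp add: b_def)
  have numeric_le: "(\<Sum>j<m. b j) \<le> (\<Sum>j\<le>n. b j * q j)"
    by (rule sum_antitone_weights_ge(1)[OF q0 q1 antitone sum_q m nm(1) c small middle bpos])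
  have numeric_eq: "q j = 0"
    if "(\<Sum>j\<le>n. b j * q j) = (\<Sum>j<m. b j)" "m \<le> j" "j \<le> n" for j
    by (rule sum_antitone_weights_ge(2)[OF q0 q1 antitone sum_q m nm(1) c small middle bpos that])
  have "real (card \<F>) \<le> real (\<Sum>j=m..n. n choose j)" using numeric_le total by simp
  then show "card \<F> \<le> (\<Sum>j=m..card S. card S choose j)"
    unfolding n_def[symmetric] of_nat_le_iff .
  assume card: "card \<F> = (\<Sum>j=m..card S. card S choose j)"
  then have eq: "(\<Sum>j\<le>n. b j * q j) = (\<Sum>j<m. b j)"
    using total unfolding n_def[symmetric] by simp
  show "\<F> = {G. G \<subseteq> S \<and> m \<le> card G}"
  proof (rule card_subset_eq[symmetric])
    show "{G. G \<subseteq> S \<and> m \<le> card G} \<subseteq> \<F>"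
    proof clarify
      fix G assume G: "G \<subseteq> S" "m \<le> card G"
      then have le: "card G \<le> n" using S(1) by (simp add: card_mono n_def)
      then have "q (card G) = 0" using numeric_eq[OF eq] G le by simp
      then have "missing S \<F> (card G) = {}"
        using missing[OF le] finite_missing[OF S(1)] by simp
      then show "G \<in> \<F>" using G by (auto simp: missing_def)
    qed
    show "finite \<F>" using sub S(1) by (auto intro: finite_subset)
    show "card {G. G \<subseteq> S \<and> m \<le> card G} = card \<F>"
      using card card_subsets_card_ge[OF S(1)] by simp
  qed
qed

section \<open>Compression towards larger sets\<close>

text \<open>
  Membership of \<open>insert x G\<close> is what blocks the move, so a set that already contains \<open>x\<close> is
  fixed in either branch.
\<close>
definition up_shift :: "'a \<Rightarrow> 'a set set \<Rightarrow> 'a set \<Rightarrow> 'a set" where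
  "up_shift x \<F> G = (if insert x G \<in> \<F> then G else insert x G)"

definition up_compress :: "'a \<Rightarrow> 'a set set \<Rightarrow> 'a set set" where
  "up_compress x \<F> = up_shift x \<F> ` \<F>"

lemma inj_on_up_shift: "inj_on (up_shift x \<F>) \<F>"
proof (rule inj_onI)
  fix G H assume "G \<in> \<F>" "H \<in> \<F>" "up_shift x \<F> G = up_shift x \<F> H"
  then show "G = H"
    by (cases "x \<in> G"; cases "x \<in> H")
      (auto simp: up_shift_def insert_absorb insert_ident split: if_splits)
qed

lemma card_up_compress: "card (up_compress x \<F>) = card \<F>"
  unfolding up_compress_def by (rule card_image[OF inj_on_up_shift])

lemma up_compress_subset: "\<F> \<subseteq> Pow S \<Longrightarrow> x \<in> S \<Longrightarrow> up_compress x \<F> \<subseteq> Pow S"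
  by (auto simp: up_compress_def up_shift_def)

lemma mem_up_compress_iff:
  "H \<in> up_compress x \<F> \<longleftrightarrow>
    (if x \<in> H then H \<in> \<F> \<or> H - {x} \<in> \<F> else H \<in> \<F> \<and> insert x H \<in> \<F>)"
proof
  assume "H \<in> up_compress x \<F>"
  then obtain G where "G \<in> \<F>" "H = up_shift x \<F> G" by (auto simp: up_compress_def)
  then show "if x \<in> H then H \<in> \<F> \<or> H - {x} \<in> \<F> else H \<in> \<F> \<and> insert x H \<in> \<F>"
    by (cases "x \<in> G") (auto simp: up_shift_def insert_absorb)
next
  assume H: "if x \<in> H then H \<in> \<F> \<or> H - {x} \<in> \<F> else H \<in> \<F> \<and> insert x H \<in> \<F>"
  consider "H \<in> \<F>" "insert x H \<in> \<F>" | "x \<in> H" "H \<notin> \<F>" "H - {x} \<in> \<F>"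
    using H by (auto simp: insert_absorb split: if_splits)
  then show "H \<in> up_compress x \<F>"
  proof cases
    case 1
    then have "up_shift x \<F> H = H" by (simp add: up_shift_def)
    then show ?thesis using 1 unfolding up_compress_def by (metis imageI)
  next
    case 2
    then have "up_shift x \<F> (H - {x}) = H" by (simp add: up_shift_def insert_absorb)
    then show ?thesis using 2 unfolding up_compress_def by (metis imageI)
  qed
qed

text \<open>
  In a partition \<open>P\<close> into compressed members, the parts avoiding \<open>x\<close> belong to \<open>\<F>\<close> both with
  and without \<open>x\<close>. If the part \<open>P i\<close> containing \<open>x\<close> is not in \<open>\<F>\<close>, then \<open>P i - {x}\<close> is, and
  handing \<open>x\<close> over to another part gives a partition into members of \<open>\<F>\<close>.
\<close>
lemma cross_partition_free_up_compress:
  assumes free: "cross_partition_free I S (\<lambda>_. \<F>)" and I: "finite I" "card I \<ge> 2" and x: "x \<in> S"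
  shows "cross_partition_free I S (\<lambda>_. up_compress x \<F>)"
  unfolding cross_partition_free_def
proof (rule notI, elim exE conjE)
  fix P
  assume mem: "\<forall>i\<in>I. P i \<in> up_compress x \<F>"
    and disj: "disjoint_family_on P I" and un: "(\<Union>i\<in>I. P i) = S"
  obtain i where i: "i \<in> I" "x \<in> P i" using un x by blast
  have notin: "x \<notin> P j" if "j \<in> I" "j \<noteq> i" for j
    using disj i that by (auto simp: disjoint_family_on_def)
  have other: "P j \<in> \<F>" "insert x (P j) \<in> \<F>" if "j \<in> I" "j \<noteq> i" for j
    using mem notin[OF that] that by (auto simp: mem_up_compress_iff)
  show False
  proof (cases "P i \<in> \<F>")
    case True
    then have "P j \<in> \<F>" if "j \<in> I" for j using other that by blast
    then show False using cross_partition_freeD[OF free _ disj un] by blast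
  next
    case False
    then have Pi: "P i - {x} \<in> \<F>" using mem i by (force simp: mem_up_compress_iff)
    have "\<not> I \<subseteq> {i}" using I card_mono[of "{i}" I] by auto
    then obtain j where j: "j \<in> I" "j \<noteq> i" by blast
    let ?P = "P(i := P i - {x}, j := insert x (P j))"
    show False
    proof (rule cross_partition_freeD[OF free])
      show "?P l \<in> \<F>" if "l \<in> I" for l
        using that Pi other j by auto
      show "disjoint_family_on ?P I"
        using disj notin unfolding disjoint_family_on_def by auto
      show "(\<Union>l\<in>I. ?P l) = S"
      proof -
        have "?P l \<subseteq> S" if "l \<in> I" for l using that un x by auto
        moreover have "y \<in> (\<Union>l\<in>I. ?P l)" if "y \<in> S" for y
        proof (cases "y = x")
          case True
          then show ?thesis using j by auto
        next
          case False
          obtain l where "l \<in> I" "y \<in> P l" using \<open>y \<in> S\<close> un by blast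
          then have "y \<in> ?P l" using False by auto
          then show ?thesis using \<open>l \<in> I\<close> by blast
        qed
        ultimately show ?thesis by blast
      qed
    qed
  qed
qed

lemma equipartition_exists:
  assumes "finite J" "finite A" "card A = card J * m"
  shows "\<exists>P. disjoint_family_on P J \<and> (\<Union>j\<in>J. P j) = A \<and> (\<forall>j\<in>J. card (P j) = m)"
  using assms
proof (induction J arbitrary: A rule: finite_induct)
  case empty
  then show ?case by (simp add: disjoint_family_on_def)
next
  case (insert j J)
  then have "m \<le> card A" by simp
  then obtain B where B: "B \<subseteq> A" "card B = m" "finite B"
    using obtain_subset_with_card_n by metis
  have "card (A - B) = card J * m" using insert B by (simp add: card_Diff_subset)
  then obtain P where P: "disjoint_family_on P J" "(\<Union>i\<in>J. P i) = A - B" "\<forall>i\<in>J. card (P i) = m"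
    using insert.IH[of "A - B"] insert.prems by auto
  let ?P = "P(j := B)"
  have eq: "?P i = P i" if "i \<in> J" for i using that insert by auto
  have "disjoint_family_on ?P (insert j J)"
    using P(1,2) insert.hyps by (fastforce simp: disjoint_family_on_def)
  moreover have "(\<Union>i\<in>J. ?P i) = (\<Union>i\<in>J. P i)" using eq by (intro SUP_cong) auto
  then have "(\<Union>i\<in>insert j J. ?P i) = A" using P(2) B(1) insert.hyps by auto
  moreover have "\<forall>i\<in>insert j J. card (?P i) = m" using P(3) B(2) by simp
  ultimately show ?case by blast
qed

text \<open>
  Suppose that \<open>\<F>\<close> contained a set \<open>G\<close> with fewer than \<open>m\<close> elements. Compression must have moved
  it, so \<open>x \<notin> G\<close> and \<open>G\<close> has size \<open>m - 1\<close>, and its complement splits into \<open>k - 1\<close> sets of size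
  \<open>m\<close>. Those that avoid \<open>x\<close> are in \<open>\<F>\<close>, with and without \<open>x\<close> added. The remaining one, \<open>H\<close>,
  is either in \<open>\<F>\<close> or becomes a member when \<open>x\<close> is taken out of it; in the latter case \<open>x\<close>
  moves to one of the other sets of size \<open>m\<close>, which exists as \<open>k \<ge> 3\<close>.
\<close>
lemma up_compress_eq_large_sets:
  assumes S: "finite S" "card S = k * m - 1" and I: "finite I" "card I = k"
    and k: "k \<ge> 3" and m: "m \<ge> 1" and sub: "\<F> \<subseteq> Pow S"
    and free: "cross_partition_free I S (\<lambda>_. \<F>)" and x: "x \<in> S"
    and eq: "up_compress x \<F> = {G. G \<subseteq> S \<and> m \<le> card G}"
  shows "\<F> = {G. G \<subseteq> S \<and> m \<le> card G}"
proof (rule card_subset_eq)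
  show "finite {G. G \<subseteq> S \<and> m \<le> card G}" using S(1) by simp
  show "card \<F> = card {G. G \<subseteq> S \<and> m \<le> card G}" using card_up_compress[of x \<F>] eq by simp
  show "\<F> \<subseteq> {G. G \<subseteq> S \<and> m \<le> card G}"
  proof (rule ccontr)
    assume "\<not> ?thesis"
    then obtain G where "G \<in> \<F>" "\<not> (G \<subseteq> S \<and> m \<le> card G)" by blast
    then have G: "G \<in> \<F>" "card G < m" using sub by auto
    have GS: "G \<subseteq> S" and fG: "finite G" using G sub S(1) by (auto intro: finite_subset)
    have "up_shift x \<F> G \<in> up_compress x \<F>" using G by (simp add: up_compress_def)
    then have "m \<le> card (up_shift x \<F> G)" using eq by simp
    then have xG: "x \<notin> G" and cG: "card G = m - 1"
      using G(2) fG by (auto simp: up_shift_def card_insert_if split: if_splits)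
    obtain i0 i1 i2 where i: "i0 \<in> I" "i1 \<in> I" "i2 \<in> I" "i0 \<noteq> i1" "i0 \<noteq> i2" "i1 \<noteq> i2"
    proof -
      obtain J where "J \<subseteq> I" "card J = 3" using k I obtain_subset_with_card_n by metis
      then show ?thesis using that unfolding card_3_iff by auto
    qed
    have km: "3 * m \<le> k * m" using k by simp
    have "card (S - G) = k * m - m" using card_Diff_subset[OF fG GS] S(2) cG m by simp
    then have "card (S - G - {x}) = k * m - m - 1" using x xG S(1) by simp
    then have "m - 1 \<le> card (S - G - {x})" using km m by linarith
    then obtain H0 where H0: "H0 \<subseteq> S - G - {x}" "card H0 = m - 1" "finite H0"
      using obtain_subset_with_card_n by metis
    define H where "H = insert x H0"
    have H: "H \<subseteq> S - G" "card H = m" "x \<in> H" "H - {x} = H0"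
      using H0 x xG m by (auto simp: H_def card_insert_if)
    have "card (S - G - H) = card (I - {i0, i1}) * m"
    proof -
      have "card (S - G - H) = k * m - m - m"
        using H(1,2) H0(3) \<open>card (S - G) = _\<close> by (subst card_Diff_subset) (auto simp: H_def)
      moreover have "card (I - {i0, i1}) = k - 2" using i I by (simp add: card_Diff_subset)
      ultimately show ?thesis by (simp add: diff_mult_distrib)
    qed
    then obtain Q where Q: "disjoint_family_on Q (I - {i0, i1})"
        "(\<Union>i\<in>I - {i0, i1}. Q i) = S - G - H" "\<forall>i\<in>I - {i0, i1}. card (Q i) = m"
      using equipartition_exists[of "I - {i0, i1}" "S - G - H" m] I S(1) by auto
    have Qsub: "Q i \<subseteq> S - G - H" if "i \<in> I - {i0, i1}" for i using Q(2) that by blast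
    have Qdisj: "Q i \<inter> Q l = {}" if "i \<in> I - {i0, i1}" "l \<in> I - {i0, i1}" "i \<noteq> l" for i l
      using Q(1) that by (auto simp: disjoint_family_on_def)
    have QF: "Q i \<in> \<F> \<and> insert x (Q i) \<in> \<F>" if "i \<in> I - {i0, i1}" for i
    proof -
      have "Q i \<subseteq> S - G - H" "card (Q i) = m" using Q that by auto
      then have "Q i \<in> up_compress x \<F>" "x \<notin> Q i" using eq H by auto
      then show ?thesis by (simp add: mem_up_compress_iff)
    qed
    have "H \<in> up_compress x \<F>" using H GS eq by auto
    then consider "H \<in> \<F>" | "H0 \<in> \<F>" using H by (auto simp: mem_up_compress_iff)
    then show False
    proof cases
      case 1
      let ?P = "Q(i0 := G, i1 := H)"
      show False
      proof (rule cross_partition_freeD[OF free])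
        show "?P i \<in> \<F>" if "i \<in> I" for i using that 1 G QF by auto
        show "disjoint_family_on ?P I"
          unfolding disjoint_family_on_def
        proof (intro ballI impI)
          fix a b assume "a \<in> I" "b \<in> I" "a \<noteq> b"
          then show "?P a \<inter> ?P b = {}"
            using Qdisj[of a b] Qsub[of a] Qsub[of b] H(1)
            by (cases "a = i0"; cases "a = i1"; cases "b = i0"; cases "b = i1"; simp; blast)
        qed
        have "(\<Union>i\<in>I. ?P i) = G \<union> H \<union> (\<Union>i\<in>I - {i0, i1}. Q i)"
          using i by (auto split: if_splits)
        then show "(\<Union>i\<in>I. ?P i) = S" using Q(2) H(1) GS by auto
      qed
    next
      case 2
      let ?P = "Q(i0 := G, i1 := H0, i2 := insert x (Q i2))"
      show False
      proof (rule cross_partition_freeD[OF free])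
        show "?P i \<in> \<F>" if "i \<in> I" for i using that 2 G QF i by auto
        show "disjoint_family_on ?P I"
          unfolding disjoint_family_on_def
        proof (intro ballI impI)
          fix a b assume "a \<in> I" "b \<in> I" "a \<noteq> b"
          then show "?P a \<inter> ?P b = {}"
            using Qdisj[of a b] Qsub[of a] Qsub[of b] H(1) H(3) H0(1) H_def xG i(4-6)
            by (cases "a = i0"; cases "a = i1"; cases "a = i2"; cases "b = i0"; cases "b = i1";
              cases "b = i2"; simp; blast)
        qed
        have "(\<Union>i\<in>I. ?P i) = G \<union> H0 \<union> {x} \<union> (\<Union>i\<in>I - {i0, i1}. Q i)"
          using i by (auto split: if_splits)
        then show "(\<Union>i\<in>I. ?P i) = S" using Q(2) H(1) GS by (auto simp: H_def)
      qed
    qed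
  qed
qed

section \<open>Arbitrary partition-free families\<close>

text \<open>
  Every effective compression lowers the total size of the complements of the members, so
  induction on that quantity reduces to families that no compression changes, which are the
  ones closed under supersets. Uniqueness travels back along each step.
\<close>
lemma partition_free_bound:
  assumes S: "finite S" "card S = k * m - 1" and I: "finite I" "card I = k"
    and k: "k \<ge> 3" and m: "m \<ge> 1"
    and sub: "\<F> \<subseteq> Pow S" and free: "cross_partition_free I S (\<lambda>_. \<F>)"
  shows "card \<F> \<le> (\<Sum>j=m..card S. card S choose j) \<and>
    (card \<F> = (\<Sum>j=m..card S. card S choose j) \<longrightarrow> \<F> = {G. G \<subseteq> S \<and> m \<le> card G})"
  using sub free
proof (induction "\<Sum>G\<in>\<F>. card (S - G)" arbitrary: \<F> rule: less_induct)
  case less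
  have fin: "finite \<F>" using less.prems(1) S(1) by (auto intro: finite_subset)
  show ?case
  proof (cases "\<forall>G\<in>\<F>. \<forall>x\<in>S. insert x G \<in> \<F>")
    case True
    then show ?thesis
      using partition_free_upset_bound[OF S I k m less.prems] by blast
  next
    case False
    then obtain G x where G: "G \<in> \<F>" "x \<in> S" "insert x G \<notin> \<F>" by blast
    let ?\<G> = "up_compress x \<F>"
    have "(\<Sum>H\<in>?\<G>. card (S - H)) = (\<Sum>H\<in>\<F>. card (S - up_shift x \<F> H))"
      unfolding up_compress_def by (simp add: sum.reindex[OF inj_on_up_shift])
    also have "\<dots> < (\<Sum>H\<in>\<F>. card (S - H))"
    proof (rule sum_strict_mono_ex1[OF fin])
      show "\<forall>H\<in>\<F>. card (S - up_shift x \<F> H) \<le> card (S - H)"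
        using S(1) by (auto simp: up_shift_def intro!: card_mono)
      have "x \<notin> G" using G by (auto simp: insert_absorb)
      then have "S - insert x G \<subset> S - G" using G by blast
      then have "card (S - up_shift x \<F> G) < card (S - G)"
        using G S(1) by (simp add: up_shift_def psubset_card_mono)
      then show "\<exists>H\<in>\<F>. card (S - up_shift x \<F> H) < card (S - H)" using G by blast
    qed
    finally have "card ?\<G> \<le> (\<Sum>j=m..card S. card S choose j) \<and>
      (card ?\<G> = (\<Sum>j=m..card S. card S choose j) \<longrightarrow> ?\<G> = {G. G \<subseteq> S \<and> m \<le> card G})"
      using less.prems G k I
      by (intro less.hyps up_compress_subset cross_partition_free_up_compress) auto
    then show ?thesis
      using up_compress_eq_large_sets[OF S I k m less.prems G(2)] by (simp add: card_up_compress)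
  qed
qed

lemma large_sets_cross_partition_free:
  assumes S: "finite S" "card S < card I * m" and I: "finite I"
  shows "cross_partition_free I S (\<lambda>_. {G. G \<subseteq> S \<and> m \<le> card G})"
  unfolding cross_partition_free_def
proof (rule notI, elim exE conjE)
  fix P
  assume mem: "\<forall>i\<in>I. P i \<in> {G. G \<subseteq> S \<and> m \<le> card G}"
    and disj: "disjoint_family_on P I" and un: "(\<Union>i\<in>I. P i) = S"
  have "card I * m \<le> (\<Sum>i\<in>I. card (P i))"
    using mem sum_mono[of I "\<lambda>_. m" "\<lambda>i. card (P i)"] by simp
  also have "\<dots> = card (\<Union>i\<in>I. P i)"
    using mem disj I S(1)
    by (intro card_UN_disjoint[symmetric]) (auto simp: disjoint_family_on_def intro: finite_subset)
  finally show False using un S(2) by simp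
qed

lemma partition_free_iff_cross_partition_free:
  "partition_free n k \<F> \<longleftrightarrow>
    \<F> \<subseteq> Pow {1..n} \<and> cross_partition_free {1..k} {1..n} (\<lambda>_. \<F>)"
  by (simp add: partition_free_def cross_partition_free_def)

theorem theorem4p2:
  fixes k m :: nat
  assumes "k \<ge> 3" and "m \<ge> 1"
  shows "max_partition_free (k * m - 1) k = (\<Sum>j = m..k * m - 1. (k * m - 1) choose j) \<and>
    (\<forall>\<F>. (partition_free (k * m - 1) k \<F> \<and>
            card \<F> = (\<Sum>j = m..k * m - 1. (k * m - 1) choose j))
         \<longleftrightarrow> \<F> = {G. G \<subseteq> {1..k * m - 1} \<and> card G \<ge> m})"
proof -
  define n where "n = k * m - 1"
  let ?N = "\<Sum>j=m..n. n choose j"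
  let ?T = "{G. G \<subseteq> {1..n} \<and> m \<le> card G}"
  have bound: "card \<F> \<le> ?N \<and> (card \<F> = ?N \<longrightarrow> \<F> = ?T)" if "partition_free n k \<F>" for \<F>
    using partition_free_bound[of "{1..n}" k m "{1..k}" \<F>] assms that
    by (simp add: partition_free_iff_cross_partition_free n_def)
  have "k * m > 0" using assms by simp
  then have "card {1..n} < card {1..k} * m" by (simp add: n_def)
  then have T: "partition_free n k ?T"
    using large_sets_cross_partition_free[of "{1..n}" "{1..k}" m]
    by (auto simp: partition_free_iff_cross_partition_free)
  have cT: "card ?T = ?N" using card_subsets_card_ge[of "{1..n}" m] by simp
  have "max_partition_free n k = ?N"
    unfolding max_partition_free_def
  proof (rule Max_eqI)
    show "finite {card \<F> |\<F>. partition_free n k \<F>}"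
      by (rule finite_subset[of _ "{..?N}"]) (use bound in blast, simp)
    show "y \<le> ?N" if "y \<in> {card \<F> |\<F>. partition_free n k \<F>}" for y
      using that bound by blast
    show "?N \<in> {card \<F> |\<F>. partition_free n k \<F>}" using T cT[symmetric] by blast
  qed
  moreover have "\<forall>\<F>. (partition_free n k \<F> \<and> card \<F> = ?N) \<longleftrightarrow> \<F> = ?T"
    using bound T cT by blast
  ultimately show ?thesis unfolding n_def by blast
qed

end
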